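(* Let $k>0$ and $\lambda>0$ be real numbers, and let $X$ be a real random variable following the Weibull distribution with shape parameter $k$ and scale parameter $\lambda$. Then for all positive integers $m,n$ with $n>m$, $$E(X^n)^{\frac{1}{n}} \geq E(X^m)^{\frac{1}{m}}.$$
   Context: The Weibull distribution with shape parameter $k>0$ and scale parameter $\lambda>0$ is the probability distribution on $\mathbb{R}$ with density (with respect to Lebesgue measure) $f(x)=\frac{k}{\lambda}\left(\frac{x}{\lambda}\right)^{k-1}e^{-(x/\lambda)^k}$ for $x>0$ and $f(x)=0$ for $x\le 0$. For a positive integer $i$, $E(X^i)=\int_{-\infty}^{\infty}x^i f(x)\,dx$ denotes the $i$-th moment of $X$. *)

theory Defs
  imports "HOL-Probability.Probability"
begin

definition weibull_density :: "real \<Rightarrow> real \<Rightarrow> real \<Rightarrow> real" where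
  "weibull_density k l x =
     (if x \<le> 0 then 0 else k / l * (x / l) powr (k - 1) * exp (- ((x / l) powr k)))"

lemma weibull_density_nonneg: "k > 0 \<Longrightarrow> l > 0 \<Longrightarrow> 0 \<le> weibull_density k l x"
  by (simp add: weibull_density_def)

lemma (in prob_space) weibull_moment:
  assumes "k > 0" "l > 0" "distributed M lborel X (weibull_density k l)"
  shows "expectation (\<lambda>\<omega>. X \<omega> ^ i) = (\<integral>x. x ^ i * weibull_density k l x \<partial>lborel)"
  using distributed_integral[OF assms(3), of "\<lambda>x. x ^ i"] weibull_density_nonneg[OF assms(1,2)]
  by (simp add: mult.commute)

end

theory Submission
  imports Defs
begin

text \<open>A Weibull variable is almost surely positive, so Jensen's inequality for the convex function
  \<open>t \<mapsto> t powr (n / m)\<close>, applied to \<open>X ^ m\<close>, gives the claim once the moments are finite. With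
  \<open>u = (x / l) powr k\<close>, every power of \<open>x\<close> is at most a constant times \<open>exp (u / 2)\<close>, and
  \<open>exp (u / 2)\<close> times the density has the explicit primitive \<open>- 2 * exp (- (u / 2))\<close>.\<close>

text \<open>From \<open>ln t \<le> t - 1\<close> at \<open>t = u / (2 * a)\<close>, multiplied by
  \<open>a\<close> and exponentiated. The scale \<open>2 * a\<close> is chosen so that the linear
  term becomes exactly \<open>u / 2\<close>.\<close>

lemma powr_le_const_times_exp:
  fixes a u :: real
  assumes "a > 0" "u > 0"
  shows "u powr a \<le> (2 * a) powr a * exp (u / 2)"
proof -
  have "ln (u / (2 * a)) \<le> u / (2 * a)"
    using assms ln_le_minus_one[of "u / (2 * a)"] by simp
  then have "a * ln (u / (2 * a)) \<le> a * (u / (2 * a))"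
    using assms by (intro mult_left_mono) auto
  then have "a * ln u \<le> a * ln (2 * a) + u / 2"
    using assms by (simp add: ln_div right_diff_distrib)
  then have "exp (a * ln u) \<le> exp (a * ln (2 * a) + u / 2)"
    by simp
  then show ?thesis
    using assms by (simp add: powr_def exp_add)
qed

lemma weibull_density_measurable [measurable]: "weibull_density k l \<in> borel_measurable borel"
  unfolding weibull_density_def [abs_def] by measurable

text \<open>For a nonnegative integrand with a known primitive, finite limits of the primitive at
  both ends already yield integrability; here they are -2 and 0.\<close>

lemma weibull_half_exponent_integrable:
  fixes k l :: real
  assumes "k > 0" "l > 0"
  shows "set_integrable lborel {0<..}
    (\<lambda>x. k / l * (x / l) powr (k - 1) * exp (- ((x / l) powr k / 2)))"
proof -
  have "set_integrable lborel (einterval 0 \<infinity>)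
    (\<lambda>x. k / l * (x / l) powr (k - 1) * exp (- ((x / l) powr k / 2)))"
  proof (rule interval_integral_FTC_nonneg(1)
      [where F = "\<lambda>x. - 2 * exp (- ((x / l) powr k / 2))" and A = "- 2" and B = 0])
    fix x :: real
    assume "(0::ereal) < ereal x"
    then have x: "x > 0" by simp
    show "((\<lambda>x. - 2 * exp (- ((x / l) powr k / 2))) has_real_derivative
        k / l * (x / l) powr (k - 1) * exp (- ((x / l) powr k / 2))) (at x)"
      using x assms by (auto intro!: derivative_eq_intros simp: field_simps)
    show "isCont (\<lambda>x. k / l * (x / l) powr (k - 1) * exp (- ((x / l) powr k / 2))) x"
      using x assms by (intro continuous_intros) auto
  next
    \<comment> \<open>The base of \<open>powr\<close> tends to 0, so the limit rule needs
      \<open>k > 0\<close> and a base that is eventually nonnegative, which approach from the right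
      supplies. The limit is -2 because \<open>0 powr k = 0\<close>.\<close>
    have "((\<lambda>x. - 2 * exp (- ((x / l) powr k / 2))) \<longlongrightarrow>
        - 2 * exp (- ((0 / l) powr k / 2))) (at_right 0)"
      using assms
      by (intro tendsto_intros)
        (auto intro!: eventually_mono[OF eventually_at_right_less])
    then show "(((\<lambda>x. - 2 * exp (- ((x / l) powr k / 2))) \<circ> real_of_ereal) \<longlongrightarrow> - 2) (at_right 0)"
      by (simp add: zero_ereal_def ereal_tendsto_simps)
    have "((\<lambda>x. - 2 * exp (- ((x / l) powr k / 2))) \<longlongrightarrow> 0) at_top"
      using assms by real_asymp
    then show "(((\<lambda>x. - 2 * exp (- ((x / l) powr k / 2))) \<circ> real_of_ereal) \<longlongrightarrow> 0) (at_left \<infinity>)"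
      by (simp add: ereal_tendsto_simps)
  qed (use assms in auto)
  then show ?thesis
    by (simp add: zero_ereal_def)
qed

lemma weibull_moment_integrable:
  fixes k l :: real
  assumes "k > 0" "l > 0" "n > 0"
  shows "integrable lborel (\<lambda>x. weibull_density k l x * x ^ n)"
proof (rule Bochner_Integration.integrable_bound)
  \<comment> \<open>With \<open>u = (x / l) powr k\<close>, the identity
    \<open>x ^ n = l ^ n * u powr a\<close> dictates \<open>a\<close>; the bound on
    \<open>u powr a\<close> then dictates \<open>C\<close>.\<close>
  define a C where "a = real n / k" and "C = l ^ n * (2 * a) powr a"
  have a: "a > 0" using assms by (simp add: a_def)
  show "integrable lborel (\<lambda>x. C * (indicator {0<..} x *
      (k / l * (x / l) powr (k - 1) * exp (- ((x / l) powr k / 2)))))"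
    using weibull_half_exponent_integrable[OF assms(1,2)]
    by (intro integrable_mult_right) (simp add: set_integrable_def)
  show "AE x in lborel. norm (weibull_density k l x * x ^ n) \<le>
      norm (C * (indicator {0<..} x *
      (k / l * (x / l) powr (k - 1) * exp (- ((x / l) powr k / 2)))))"
  proof (rule AE_I2)
    fix x :: real
    show "norm (weibull_density k l x * x ^ n) \<le>
      norm (C * (indicator {0<..} x *
      (k / l * (x / l) powr (k - 1) * exp (- ((x / l) powr k / 2)))))"
    proof (cases "x > 0")
      case True
      define u d where "u = (x / l) powr k" and "d = k / l * (x / l) powr (k - 1)"
      have u: "u > 0" and d: "d > 0" using True assms by (auto simp: u_def d_def)
      have "x ^ n = l ^ n * (x / l) powr real n"
        using True assms by (simp add: powr_realpow power_divide)
      also have "(x / l) powr real n = u powr a"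
        using assms by (simp add: u_def a_def powr_powr)
      also have "l ^ n * u powr a \<le> C * exp (u / 2)"
        unfolding C_def mult.assoc using assms powr_le_const_times_exp[OF a u]
        by (intro mult_left_mono) auto
      finally have "d * exp (- u) * x ^ n \<le> d * exp (- u) * (C * exp (u / 2))"
        using d by (intro mult_left_mono) auto
      also have "\<dots> = C * (d * (exp (- u) * exp (u / 2)))" by simp
      \<comment> \<open>Half of the exponential decay has absorbed the power of \<open>x\<close>;
        the other half keeps the bound integrable.\<close>
      also have "exp (- u) * exp (u / 2) = exp (- (u / 2))"
        by (simp flip: exp_add)
      finally have "d * exp (- u) * x ^ n \<le> C * (d * exp (- (u / 2)))" .
      moreover have "0 \<le> d * exp (- u) * x ^ n" using d True by simp
      moreover have "weibull_density k l x = d * exp (- u)"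
        using True by (simp add: weibull_density_def u_def d_def)
      ultimately show ?thesis
        using True unfolding u_def[symmetric] d_def[symmetric] by simp
    qed (simp add: weibull_density_def)
  qed
qed simp

text \<open>Isolates the part of the argument that sees the distribution only through almost sure
  positivity and finite moments.\<close>

lemma (in prob_space) power_mean_mono:
  fixes X :: "'a \<Rightarrow> real"
  assumes "AE \<omega> in M. X \<omega> > 0"
    and int: "integrable M (\<lambda>\<omega>. X \<omega> ^ m)" "integrable M (\<lambda>\<omega>. X \<omega> ^ n)"
    and "0 < m" "m \<le> n"
  shows "expectation (\<lambda>\<omega>. X \<omega> ^ m) powr (1 / m) \<le> expectation (\<lambda>\<omega>. X \<omega> ^ n) powr (1 / n)"
proof -
  define p where "p = real n / real m"
  have p: "p \<ge> 1" using assms by (simp add: p_def)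
  \<comment> \<open>Rewriting the iterated power uses \<open>X \<omega> > 0\<close>, so the identity
    is only claimed almost everywhere. That suffices to transfer integrability and the
    expectation.\<close>
  have eq: "AE \<omega> in M. (X \<omega> ^ m) powr p = X \<omega> ^ n"
    using assms(1)
  proof eventually_elim
    case (elim \<omega>)
    then have "(X \<omega> ^ m) powr p = X \<omega> powr (real m * p)"
      by (simp add: powr_powr flip: powr_realpow)
    also have "\<dots> = X \<omega> ^ n"
      using elim assms(4) by (simp add: p_def powr_realpow)
    finally show ?case .
  qed
  have "expectation (\<lambda>\<omega>. X \<omega> ^ m) powr p \<le> expectation (\<lambda>\<omega>. (X \<omega> ^ m) powr p)"
  proof (rule jensens_inequality[where I = "{0<..}" and a = 0])
    show "AE \<omega> in M. X \<omega> ^ m \<in> {0<..}"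
      using assms(1) by eventually_elim simp
    show "integrable M (\<lambda>\<omega>. (X \<omega> ^ m) powr p)"
      using int eq integrable_cong_AE[of "\<lambda>\<omega>. (X \<omega> ^ m) powr p" M "\<lambda>\<omega>. X \<omega> ^ n"]
      by auto
    show "convex_on {0<..} (\<lambda>x. x powr p)"
      by (rule powr_convex[OF p])
  qed (use int in auto)
  also have "expectation (\<lambda>\<omega>. (X \<omega> ^ m) powr p) = expectation (\<lambda>\<omega>. X \<omega> ^ n)"
    using int eq by (intro integral_cong_AE) auto
  \<comment> \<open>Taking n-th roots turns the exponent \<open>p\<close> on the left into
    \<open>p / n = 1 / m\<close>.\<close>
  finally have "(expectation (\<lambda>\<omega>. X \<omega> ^ m) powr p) powr (1 / n)
      \<le> expectation (\<lambda>\<omega>. X \<omega> ^ n) powr (1 / n)"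
    by (intro powr_mono2) auto
  then show ?thesis
    using assms(4,5) by (simp add: powr_powr p_def)
qed

theorem theorem1:
  fixes k l :: real and M :: "'a measure" and X :: "'a \<Rightarrow> real" and m n :: nat
  assumes "k > 0" and "l > 0"
    and "prob_space M"
    and "distributed M lborel X (weibull_density k l)"
    and "m > 0" and "n > m"
  shows "(prob_space.expectation M (\<lambda>\<omega>. X \<omega> ^ n)) powr (1 / real n)
       \<ge> (prob_space.expectation M (\<lambda>\<omega>. X \<omega> ^ m)) powr (1 / real m)"
proof -
  interpret prob_space M by fact
  have integrable: "integrable M (\<lambda>\<omega>. X \<omega> ^ i)" if "i > 0" for i
    using distributed_integrable[OF assms(4), of "\<lambda>x. x ^ i"]
      weibull_moment_integrable[OF assms(1,2) that] weibull_density_nonneg[OF assms(1,2)]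
    by simp
  \<comment> \<open>The density vanishes on the nonpositive half-line, so the law of
    \<open>X\<close> gives it no mass; this is then pulled back along \<open>X\<close>.\<close>
  have "AE x in distr M lborel X. x > 0"
    unfolding distributed_distr_eq_density[OF assms(4)]
    by (subst AE_density) (auto simp: weibull_density_def)
  then have "AE \<omega> in M. X \<omega> > 0"
    using distributed_measurable[OF assms(4)] by (subst (asm) AE_distr_iff) auto
  then show ?thesis
    using assms(5,6) by (intro power_mean_mono integrable) auto
qed

end
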